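(* For all integers $2 \le i \le j \le n$, the group homomorphism $J_n^{i,j} \to J_n$ defined on generators by $s_{p,q} \mapsto s_{p,q}$ is injective.
   Context: For $n \ge 2$, the cactus group $J_n$ is the group with generators $s_{p,q}$ for $1 \le p < q \le n$ and relations: (j1) $s_{p,q}^2 = 1$; (j2) $s_{p,q}s_{m,r} = s_{m,r}s_{p,q}$ whenever $[p,q]\cap[m,r]=\emptyset$; (j3) $s_{p,q}s_{m,r} = s_{p+q-r,\,p+q-m}\,s_{p,q}$ whenever $[m,r]\subset[p,q]$ (intervals of integers). The leaf number of $s_{p,q}$ is $q-p+1$. For $2\le i\le j\le n$, $J_n^{i,j}$ is the group with generators $s_{p,q}$ for $1\le p<q\le n$ with $i \le q-p+1 \le j$, and as relations all the relations (j1)–(j3) that involve only these generators. *)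

theory Defs
  imports "HOL-Algebra.Group"
begin

text \<open>The letter \<open>(x, True)\<close> stands for the generator \<open>x\<close>, the letter \<open>(x, False)\<close> for its
  formal inverse. A relation \<open>l = r\<close> is a pair of words \<open>(l, r)\<close>.\<close>

type_synonym 'a word = "('a \<times> bool) list"

definition words :: "'a set \<Rightarrow> 'a word set" where
  "words S = lists (S \<times> UNIV)"

inductive_set pres_cong :: "'a set \<Rightarrow> ('a word \<times> 'a word) set \<Rightarrow> ('a word \<times> 'a word) set"
  for S :: "'a set" and R :: "('a word \<times> 'a word) set" where
  refl: "w \<in> words S \<Longrightarrow> (w, w) \<in> pres_cong S R"
| sym: "(v, w) \<in> pres_cong S R \<Longrightarrow> (w, v) \<in> pres_cong S R"
| trans: "(u, v) \<in> pres_cong S R \<Longrightarrow> (v, w) \<in> pres_cong S R \<Longrightarrow> (u, w) \<in> pres_cong S R"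
| cancel: "u \<in> words S \<Longrightarrow> v \<in> words S \<Longrightarrow> x \<in> S \<Longrightarrow>
    (u @ [(x, b), (x, \<not> b)] @ v, u @ v) \<in> pres_cong S R"
| rel: "u \<in> words S \<Longrightarrow> v \<in> words S \<Longrightarrow> (l, r) \<in> R \<Longrightarrow>
    (u @ l @ v, u @ r @ v) \<in> pres_cong S R"

text \<open>The group \<open>\<langle>S | R\<rangle>\<close>; meaningful if all relations are between words over \<open>S\<close>.\<close>

definition presented_group :: "'a set \<Rightarrow> ('a word \<times> 'a word) set \<Rightarrow> 'a word set monoid" where
  "presented_group S R =
    \<lparr>carrier = words S // pres_cong S R,
     monoid.mult = (\<lambda>A B. \<Union>a\<in>A. \<Union>b\<in>B. pres_cong S R `` {a @ b}),
     one = pres_cong S R `` {[]}\<rparr>"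

definition pres_gen :: "'a set \<Rightarrow> ('a word \<times> 'a word) set \<Rightarrow> 'a \<Rightarrow> 'a word set" where
  "pres_gen S R x = pres_cong S R `` {[(x, True)]}"

lemma words_simps [simp]:
  "[] \<in> words S"
  "a # w \<in> words S \<longleftrightarrow> fst a \<in> S \<and> w \<in> words S"
  "v @ w \<in> words S \<longleftrightarrow> v \<in> words S \<and> w \<in> words S"
  "rev w \<in> words S \<longleftrightarrow> w \<in> words S"
  by (cases a; auto simp: words_def)+

context
  fixes S :: "'a set" and R :: "('a word \<times> 'a word) set"
  assumes R: "R \<subseteq> words S \<times> words S"
begin

lemma pres_cong_words: "(v, w) \<in> pres_cong S R \<Longrightarrow> v \<in> words S \<and> w \<in> words S"
  by (induction rule: pres_cong.induct) (use R in auto)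

lemma equiv_pres_cong: "equiv (words S) (pres_cong S R)"
proof (rule equivI)
  show "pres_cong S R \<subseteq> words S \<times> words S" using pres_cong_words by auto
  show "refl_on (words S) (pres_cong S R)"
    by (auto intro!: refl_onI pres_cong.refl)
  show "sym_on UNIV (pres_cong S R)" by (rule symI) (rule pres_cong.sym)
  show "trans_on UNIV (pres_cong S R)" by (rule transI) (rule pres_cong.trans)
qed

lemma pres_cong_append_left:
  "(v, w) \<in> pres_cong S R \<Longrightarrow> a \<in> words S \<Longrightarrow> (a @ v, a @ w) \<in> pres_cong S R"
proof (induction rule: pres_cong.induct)
  case (cancel u v x b)
  then show ?case using pres_cong.cancel[of "a @ u" S v x b R] by simp
next
  case (rel u v l r)
  then show ?case using pres_cong.rel[of "a @ u" S v l r R] by simp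
next
  case (trans u v w)
  then show ?case by (blast intro: pres_cong.trans)
qed (simp_all add: pres_cong.refl pres_cong.sym)

lemma pres_cong_append_right:
  "(v, w) \<in> pres_cong S R \<Longrightarrow> a \<in> words S \<Longrightarrow> (v @ a, w @ a) \<in> pres_cong S R"
proof (induction rule: pres_cong.induct)
  case (cancel u v x b)
  then show ?case using pres_cong.cancel[of u S "v @ a" x b R] by simp
next
  case (rel u v l r)
  then show ?case using pres_cong.rel[of u S "v @ a" l r R] by simp
next
  case (trans u v w)
  then show ?case by (blast intro: pres_cong.trans)
qed (simp_all add: pres_cong.refl pres_cong.sym)

lemma pres_cong_append:
  "(v, w) \<in> pres_cong S R \<Longrightarrow> (v', w') \<in> pres_cong S R \<Longrightarrow> (v @ v', w @ w') \<in> pres_cong S R"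
  by (meson pres_cong.trans pres_cong_append_left pres_cong_append_right pres_cong_words)

lemma presented_group_mult:
  assumes "v \<in> words S" "w \<in> words S"
  shows "pres_cong S R `` {v} \<otimes>\<^bsub>presented_group S R\<^esub> pres_cong S R `` {w} =
    pres_cong S R `` {v @ w}"
proof -
  have "pres_cong S R `` {a @ b} = pres_cong S R `` {v @ w}"
    if "(v, a) \<in> pres_cong S R" "(w, b) \<in> pres_cong S R" for a b
    using equiv_class_eq[OF equiv_pres_cong pres_cong_append[OF that]] by simp
  moreover have "(v, v) \<in> pres_cong S R" "(w, w) \<in> pres_cong S R"
    using assms by (auto intro: pres_cong.refl)
  ultimately have "(\<Union>a\<in>pres_cong S R `` {v}. \<Union>b\<in>pres_cong S R `` {w}. pres_cong S R `` {a @ b}) =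
      pres_cong S R `` {v @ w}"
    by blast
  then show ?thesis by (simp add: presented_group_def)
qed

lemma pres_cong_inverse:
  "w \<in> words S \<Longrightarrow> (rev (map (\<lambda>(x, b). (x, \<not> b)) w) @ w, []) \<in> pres_cong S R"
proof (induction w)
  case Nil
  then show ?case by (auto intro: pres_cong.refl)
next
  case (Cons a w)
  obtain x b where a: "a = (x, b)" by force
  let ?i = "rev (map (\<lambda>(x, b). (x, \<not> b)) w)"
  have "map (\<lambda>(x, b). (x, \<not> b)) w \<in> words S"
    using Cons.prems by (auto simp: words_def in_lists_conv_set)
  then have "(?i @ [(x, \<not> b), (x, \<not> \<not> b)] @ w, ?i @ w) \<in> pres_cong S R"
    using Cons.prems a by (intro pres_cong.cancel) auto
  then have "(?i @ [(x, \<not> b), (x, \<not> \<not> b)] @ w, []) \<in> pres_cong S R"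
    by (rule pres_cong.trans) (use Cons in simp)
  then show ?case by (simp add: a)
qed

lemma group_presented_group: "group (presented_group S R)"
proof (rule groupI)
  let ?G = "presented_group S R"
  have carr: "carrier ?G = words S // pres_cong S R"
    and one: "\<one>\<^bsub>?G\<^esub> = pres_cong S R `` {[]}"
    by (simp_all add: presented_group_def)
  note m = presented_group_mult
  show "\<one>\<^bsub>?G\<^esub> \<in> carrier ?G" by (simp add: carr one quotientI)
  fix A assume A: "A \<in> carrier ?G"
  then obtain a where a: "a \<in> words S" "A = pres_cong S R `` {a}"
    by (auto simp: carr elim: quotientE)
  show "\<one>\<^bsub>?G\<^esub> \<otimes>\<^bsub>?G\<^esub> A = A" using a m[of "[]" a] by (simp add: one)
  let ?i = "rev (map (\<lambda>(x, b). (x, \<not> b)) a)"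
  have i: "?i \<in> words S" using a by (auto simp: words_def in_lists_conv_set)
  show "\<exists>B\<in>carrier ?G. B \<otimes>\<^bsub>?G\<^esub> A = \<one>\<^bsub>?G\<^esub>"
    using a i m[OF i a(1)] equiv_class_eq[OF equiv_pres_cong pres_cong_inverse[OF a(1)]]
    by (intro bexI[of _ "pres_cong S R `` {?i}"]) (auto simp: one carr quotientI)
  fix B assume "B \<in> carrier ?G"
  then obtain b where b: "b \<in> words S" "B = pres_cong S R `` {b}"
    by (auto simp: carr elim: quotientE)
  show "A \<otimes>\<^bsub>?G\<^esub> B \<in> carrier ?G" using a b by (simp add: m carr quotientI)
  fix C assume "C \<in> carrier ?G"
  then obtain c where c: "c \<in> words S" "C = pres_cong S R `` {c}"
    by (auto simp: carr elim: quotientE)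
  show "A \<otimes>\<^bsub>?G\<^esub> B \<otimes>\<^bsub>?G\<^esub> C = A \<otimes>\<^bsub>?G\<^esub> (B \<otimes>\<^bsub>?G\<^esub> C)" using a b c by (simp add: m)
qed

end

text \<open>The pair \<open>(p, q)\<close> names the generator \<open>s\<^sub>p\<^sub>,\<^sub>q\<close>.\<close>

definition cactus_gens :: "nat \<Rightarrow> (nat \<times> nat) set" where
  "cactus_gens n = {(p, q). 1 \<le> p \<and> p < q \<and> q \<le> n}"

definition leaf_number :: "nat \<times> nat \<Rightarrow> nat" where
  "leaf_number = (\<lambda>(p, q). q - p + 1)"

abbreviation s_letter :: "nat \<Rightarrow> nat \<Rightarrow> (nat \<times> nat) \<times> bool" where
  "s_letter p q \<equiv> ((p, q), True)"

text \<open>In the last family \<open>m \<le> r \<le> q\<close>, so the natural number subtractions do not truncate.\<close>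

definition cactus_rels :: "nat \<Rightarrow> ((nat \<times> nat) word \<times> (nat \<times> nat) word) set" where
  "cactus_rels n =
    {([s_letter p q, s_letter p q], []) | p q. (p, q) \<in> cactus_gens n} \<union>
    {([s_letter p q, s_letter m r], [s_letter m r, s_letter p q]) | p q m r.
      (p, q) \<in> cactus_gens n \<and> (m, r) \<in> cactus_gens n \<and> {p..q} \<inter> {m..r} = {}} \<union>
    {([s_letter p q, s_letter m r], [s_letter (p + q - r) (p + q - m), s_letter p q]) | p q m r.
      (p, q) \<in> cactus_gens n \<and> (m, r) \<in> cactus_gens n \<and> {m..r} \<subseteq> {p..q}}"

definition cactus_group :: "nat \<Rightarrow> (nat \<times> nat) word set monoid" where
  "cactus_group n = presented_group (cactus_gens n) (cactus_rels n)"

definition cactus_s :: "nat \<Rightarrow> nat \<times> nat \<Rightarrow> (nat \<times> nat) word set" where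
  "cactus_s n = pres_gen (cactus_gens n) (cactus_rels n)"

definition sub_cactus_gens :: "nat \<Rightarrow> nat \<Rightarrow> nat \<Rightarrow> (nat \<times> nat) set" where
  "sub_cactus_gens n i j = {g \<in> cactus_gens n. i \<le> leaf_number g \<and> leaf_number g \<le> j}"

definition sub_cactus_rels ::
    "nat \<Rightarrow> nat \<Rightarrow> nat \<Rightarrow> ((nat \<times> nat) word \<times> (nat \<times> nat) word) set" where
  "sub_cactus_rels n i j =
    cactus_rels n \<inter> (words (sub_cactus_gens n i j) \<times> words (sub_cactus_gens n i j))"

definition sub_cactus_group :: "nat \<Rightarrow> nat \<Rightarrow> nat \<Rightarrow> (nat \<times> nat) word set monoid" where
  "sub_cactus_group n i j = presented_group (sub_cactus_gens n i j) (sub_cactus_rels n i j)"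

definition sub_cactus_s :: "nat \<Rightarrow> nat \<Rightarrow> nat \<Rightarrow> nat \<times> nat \<Rightarrow> (nat \<times> nat) word set" where
  "sub_cactus_s n i j = pres_gen (sub_cactus_gens n i j) (sub_cactus_rels n i j)"

lemma cactus_rels_words: "cactus_rels n \<subseteq> words (cactus_gens n) \<times> words (cactus_gens n)"
  by (auto simp: cactus_rels_def cactus_gens_def)

lemma group_cactus_group: "group (cactus_group n)"
  unfolding cactus_group_def by (rule group_presented_group[OF cactus_rels_words])

lemma group_sub_cactus_group: "group (sub_cactus_group n i j)"
  unfolding sub_cactus_group_def sub_cactus_rels_def by (rule group_presented_group) blast

end

theory Submission
  imports Defs "HOL-Algebra.Coset"
begin

text \<open>Reversing the interval \<open>[p,q]\<close> of strands, followed by the reflection at \<open>[p,q]\<close> in the dual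
  geometric representation of a right-angled Coxeter group (one Coxeter generator for each set of
  strands, disjoint or nested sets commuting), is the action of \<open>s\<^sub>p\<^sub>,\<^sub>q\<close> in a representation of
  \<open>J\<^sub>n\<close> on integer-valued functions on sets of strands. Let a word of minimal length in its class
  in \<open>J\<^sub>n\<^sup>i\<^sup>,\<^sup>j\<close> act on the constant function 1. A set \<open>I\<close> receives a negative value only if the
  word equals in \<open>J\<^sub>n\<^sup>i\<^sup>,\<^sup>j\<close> a word of the same length that begins with the generator of \<open>I\<close>:
  two generators whose reflections commute can be exchanged by a relation, and this relation
  preserves leaf numbers. A nonempty minimal word does produce a negative value, at the interval of
  its first letter, so it is nontrivial in \<open>J\<^sub>n\<close>.\<close>

section \<open>Presented groups\<close>

abbreviation word_class :: "'a set \<Rightarrow> ('a word \<times> 'a word) set \<Rightarrow> 'a word \<Rightarrow> 'a word set" where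
  "word_class S R w \<equiv> pres_cong S R `` {w}"

lemma words_mono: "S \<subseteq> T \<Longrightarrow> words S \<subseteq> words T"
  by (auto simp: words_def)

lemma pres_cong_mono:
  assumes "S \<subseteq> T" "R \<subseteq> Q"
  shows "pres_cong S R \<subseteq> pres_cong T Q"
proof -
  have "(v, w) \<in> pres_cong T Q" if "(v, w) \<in> pres_cong S R" for v w
    using that
  proof induction
    case (trans u v w)
    then show ?case by (blast intro: pres_cong.trans)
  qed (use assms words_mono[OF assms(1)] in
      \<open>auto intro: pres_cong.refl pres_cong.sym pres_cong.cancel[simplified] pres_cong.rel\<close>)
  then show ?thesis by auto
qed

lemma pres_cong_relation: "(l, r) \<in> R \<Longrightarrow> (l, r) \<in> pres_cong S R"
  using pres_cong.rel[of "[]" S "[]"] by simp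

lemma carrier_presented_group: "carrier (presented_group S R) = word_class S R ` words S"
  by (auto simp: presented_group_def quotient_def)

lemma one_presented_group: "\<one>\<^bsub>presented_group S R\<^esub> = word_class S R []"
  by (simp add: presented_group_def)

declare pres_cong.trans [trans]

definition minimal_word :: "'a set \<Rightarrow> ('a word \<times> 'a word) set \<Rightarrow> 'a word \<Rightarrow> bool" where
  "minimal_word S R w \<longleftrightarrow> w \<in> words S \<and> (\<forall>v. (w, v) \<in> pres_cong S R \<longrightarrow> length w \<le> length v)"

context
  fixes S :: "'a set" and R :: "('a word \<times> 'a word) set"
  assumes R: "R \<subseteq> words S \<times> words S"
begin

lemma minimal_word_exists:
  assumes "w \<in> words S"
  obtains v where "(w, v) \<in> pres_cong S R" "minimal_word S R v"
proof -
  have "(w, w) \<in> pres_cong S R" using assms by (rule pres_cong.refl)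
  then obtain v where v: "(w, v) \<in> pres_cong S R"
      "\<forall>u. (w, u) \<in> pres_cong S R \<longrightarrow> length v \<le> length u"
    using ex_has_least_nat[of "\<lambda>v. (w, v) \<in> pres_cong S R" w length] by blast
  then have "minimal_word S R v"
    using pres_cong_words[OF R] by (auto simp: minimal_word_def intro: pres_cong.trans)
  with v that show thesis by blast
qed

lemma minimal_word_Cons:
  assumes "minimal_word S R (a # w)"
  shows "minimal_word S R w"
proof -
  have "length w \<le> length v" if "(w, v) \<in> pres_cong S R" for v
    using pres_cong_append_left[OF R that, of "[a]"] assms by (fastforce simp: minimal_word_def)
  then show ?thesis using assms by (simp add: minimal_word_def)
qed

lemma word_class_eq_iff:
  "v \<in> words S \<Longrightarrow> w \<in> words S \<Longrightarrow>
    word_class S R v = word_class S R w \<longleftrightarrow> (v, w) \<in> pres_cong S R"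
  using eq_equiv_class_iff[OF equiv_pres_cong[OF R]] by blast

lemma word_class_inverse_letter:
  assumes "x \<in> S"
  shows "word_class S R [(x, False)] = inv\<^bsub>presented_group S R\<^esub> (pres_gen S R x)"
proof -
  interpret group "presented_group S R" by (rule group_presented_group[OF R])
  have "([(x, False), (x, True)], []) \<in> pres_cong S R"
    using pres_cong.cancel[of "[]" S "[]" x False R] assms by simp
  then have "word_class S R [(x, False)] \<otimes>\<^bsub>presented_group S R\<^esub> pres_gen S R x =
      \<one>\<^bsub>presented_group S R\<^esub>"
    using assms
    by (simp add: pres_gen_def presented_group_mult[OF R] one_presented_group word_class_eq_iff)
  then have "inv\<^bsub>presented_group S R\<^esub> (pres_gen S R x) = word_class S R [(x, False)]"
    using assms by (intro inv_equality) (auto simp: carrier_presented_group pres_gen_def)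
  then show ?thesis ..
qed

lemma hom_eq_on_presented_group:
  assumes "group G" and \<phi>: "\<phi> \<in> hom (presented_group S R) G"
    and \<psi>: "\<psi> \<in> hom (presented_group S R) G"
    and gens: "\<And>x. x \<in> S \<Longrightarrow> \<phi> (pres_gen S R x) = \<psi> (pres_gen S R x)"
    and "A \<in> carrier (presented_group S R)"
  shows "\<phi> A = \<psi> A"
proof -
  interpret \<phi>: group_hom "presented_group S R" G \<phi>
    using assms group_presented_group[OF R] by (simp add: group_hom_def group_hom_axioms_def)
  interpret \<psi>: group_hom "presented_group S R" G \<psi>
    using assms group_presented_group[OF R] by (simp add: group_hom_def group_hom_axioms_def)
  have letter: "\<phi> (word_class S R [(x, b)]) = \<psi> (word_class S R [(x, b)])" if "x \<in> S" for x b
  proof (cases b)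
    case True
    then show ?thesis using gens that by (simp add: pres_gen_def)
  next
    case False
    have "pres_gen S R x \<in> carrier (presented_group S R)"
      using that by (simp add: carrier_presented_group pres_gen_def)
    then show ?thesis using False that gens by (simp add: word_class_inverse_letter)
  qed
  have "\<phi> (word_class S R w) = \<psi> (word_class S R w)" if "w \<in> words S" for w
    using that
  proof (induction w)
    case Nil
    then show ?case using \<phi>.hom_one \<psi>.hom_one by (simp add: one_presented_group)
  next
    case (Cons a w)
    have "word_class S R (a # w) =
        word_class S R [a] \<otimes>\<^bsub>presented_group S R\<^esub> word_class S R w"
      using Cons.prems by (simp add: presented_group_mult[OF R])
    then show ?case
      using Cons letter[of "fst a" "snd a"] by (simp add: carrier_presented_group)
  qed
  then show ?thesis using assms(5) by (auto simp: carrier_presented_group)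
qed

end

definition presentation_map ::
    "'a set \<Rightarrow> ('a word \<times> 'a word) set \<Rightarrow> 'a word set \<Rightarrow> 'a word set" where
  "presentation_map T Q A = pres_cong T Q `` A"

locale subpresentation =
  fixes S T :: "'a set" and R Q :: "('a word \<times> 'a word) set"
  assumes sub_relations: "R \<subseteq> words S \<times> words S"
    and relations: "Q \<subseteq> words T \<times> words T"
    and generators_subset: "S \<subseteq> T"
    and relations_subset: "R \<subseteq> Q"
begin

lemmas pres_cong_subset = pres_cong_mono[OF generators_subset relations_subset]
lemmas words_subset = words_mono[OF generators_subset]

lemma presentation_map_word_class:
  assumes "w \<in> words S"
  shows "presentation_map T Q (word_class S R w) = word_class T Q w"
  using assms pres_cong_subset
  by (auto simp: presentation_map_def intro: pres_cong.trans pres_cong.refl)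

lemma presentation_map_pres_gen: "x \<in> S \<Longrightarrow> presentation_map T Q (pres_gen S R x) = pres_gen T Q x"
  by (simp add: pres_gen_def presentation_map_word_class)

lemma presentation_map_hom:
  "presentation_map T Q \<in> hom (presented_group S R) (presented_group T Q)"
proof (rule homI)
  fix A assume "A \<in> carrier (presented_group S R)"
  then obtain v where v: "v \<in> words S" "A = word_class S R v"
    by (auto simp: carrier_presented_group)
  then show "presentation_map T Q A \<in> carrier (presented_group T Q)"
    using words_subset
    by (auto simp: presentation_map_word_class carrier_presented_group)
  fix B assume "B \<in> carrier (presented_group S R)"
  then obtain w where w: "w \<in> words S" "B = word_class S R w"
    by (auto simp: carrier_presented_group)
  show "presentation_map T Q (A \<otimes>\<^bsub>presented_group S R\<^esub> B) =
      presentation_map T Q A \<otimes>\<^bsub>presented_group T Q\<^esub> presentation_map T Q B"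
    using v w subsetD[OF words_subset]
    by (simp add: presentation_map_word_class presented_group_mult[OF sub_relations]
        presented_group_mult[OF relations])
qed

lemma inj_on_presentation_map:
  assumes "\<And>w. w \<in> words S \<Longrightarrow> (w, []) \<in> pres_cong T Q \<Longrightarrow> (w, []) \<in> pres_cong S R"
  shows "inj_on (presentation_map T Q) (carrier (presented_group S R))"
proof -
  have "A = \<one>\<^bsub>presented_group S R\<^esub>"
    if A: "A \<in> carrier (presented_group S R)"
      and one: "presentation_map T Q A = \<one>\<^bsub>presented_group T Q\<^esub>" for A
  proof -
    obtain w where w: "w \<in> words S" "A = word_class S R w"
      using A by (auto simp: carrier_presented_group)
    then have "(w, []) \<in> pres_cong T Q"
      using one subsetD[OF words_subset]
      by (simp add: presentation_map_word_class one_presented_group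
          word_class_eq_iff[OF relations])
    then show ?thesis
      using assms w
      by (simp add: one_presented_group word_class_eq_iff[OF sub_relations])
  qed
  then show ?thesis
    using inj_on_one_iff'[OF presentation_map_hom group_presented_group[OF sub_relations]
        group_presented_group[OF relations]] by blast
qed

end

section \<open>Twisted reflections\<close>

definition reflection :: "('b \<Rightarrow> 'b \<Rightarrow> bool) \<Rightarrow> 'b \<Rightarrow> ('b \<Rightarrow> int) \<Rightarrow> 'b \<Rightarrow> int" where
  "reflection commutes a f b =
    (if b = a then - f a else if commutes a b then f b else f b + 2 * f a)"

lemma reflection_involution: "reflection commutes a (reflection commutes a f) = f"
  by (auto simp: reflection_def fun_eq_iff)

lemma reflection_commute:
  assumes "commutes a b" "commutes b a"
  shows "reflection commutes a (reflection commutes b f) =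
    reflection commutes b (reflection commutes a f)"
  using assms by (auto simp: reflection_def fun_eq_iff)

locale twisted_reflections =
  fixes commutes :: "'b \<Rightarrow> 'b \<Rightarrow> bool"
    and root :: "'a \<Rightarrow> 'b"
    and twist :: "'a \<Rightarrow> 'b \<Rightarrow> 'b"
  assumes commutes_refl: "commutes a a"
    and commutes_sym: "commutes a b \<Longrightarrow> commutes b a"
    and commutes_twist: "commutes (twist x a) (twist x b) \<longleftrightarrow> commutes a b"
    and twist_twist [simp]: "twist x (twist x a) = a"
    and twist_root [simp]: "twist x (root x) = root x"
begin

definition gen_act :: "'a \<Rightarrow> ('b \<Rightarrow> int) \<Rightarrow> 'b \<Rightarrow> int" where
  "gen_act x f = reflection commutes (root x) (f \<circ> twist x)"

definition word_act :: "'a word \<Rightarrow> ('b \<Rightarrow> int) \<Rightarrow> 'b \<Rightarrow> int" where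
  "word_act w = foldr (gen_act \<circ> fst) w"

lemma word_act_simps [simp]:
  "word_act [] f = f"
  "word_act (a # w) f = gen_act (fst a) (word_act w f)"
  "word_act (v @ w) f = word_act v (word_act w f)"
  by (simp_all add: word_act_def)

lemma commutes_root_twist: "commutes (root x) (twist x a) \<longleftrightarrow> commutes (root x) a"
  using commutes_twist[of x "root x" a] by simp

lemma gen_act_root: "gen_act x f (root x) = - f (root x)"
  by (simp add: gen_act_def reflection_def)

lemma gen_act_commutes:
  "a \<noteq> root x \<Longrightarrow> commutes (root x) a \<Longrightarrow> gen_act x f a = f (twist x a)"
  by (simp add: gen_act_def reflection_def)

lemma gen_act_not_commutes:
  "\<not> commutes (root x) a \<Longrightarrow> gen_act x f a = f (twist x a) + 2 * f (root x)"
  using commutes_refl by (auto simp: gen_act_def reflection_def)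

lemma reflection_twist:
  "reflection commutes a f \<circ> twist x = reflection commutes (twist x a) (f \<circ> twist x)"
proof
  fix b
  have "twist x b = a \<longleftrightarrow> b = twist x a" by auto
  moreover have "commutes a (twist x b) \<longleftrightarrow> commutes (twist x a) b"
    using commutes_twist[of x "twist x a" b] by simp
  ultimately show "(reflection commutes a f \<circ> twist x) b =
      reflection commutes (twist x a) (f \<circ> twist x) b"
    by (simp add: reflection_def)
qed

lemma gen_act_gen_act:
  "gen_act x (gen_act y f) =
    reflection commutes (root x) (reflection commutes (twist x (root y)) (f \<circ> (twist y \<circ> twist x)))"
  by (simp add: gen_act_def reflection_twist comp_assoc)

lemma gen_act_involution: "gen_act x (gen_act x f) = f"
  by (simp add: gen_act_gen_act reflection_involution comp_def)

lemma gen_act_swap: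
  assumes "commutes (root x) (root z)"
    and "root z = twist x (root y)" and "root x = twist z (root x')"
    and "\<And>a. twist y (twist x a) = twist x' (twist z a)"
  shows "gen_act x (gen_act y f) = gen_act z (gen_act x' f)"
proof -
  have "twist y \<circ> twist x = twist x' \<circ> twist z" using assms(4) by auto
  then show ?thesis
    using reflection_commute[of commutes, OF assms(1) commutes_sym[OF assms(1)]]
    by (simp add: gen_act_gen_act flip: assms(2,3))
qed

lemma word_act_pres_cong:
  assumes "\<And>l r f. (l, r) \<in> R \<Longrightarrow> word_act l f = word_act r f"
  shows "(v, w) \<in> pres_cong S R \<Longrightarrow> word_act v f = word_act w f"
  by (induction arbitrary: f rule: pres_cong.induct) (simp_all add: gen_act_involution assms)

end

section \<open>Minimal words under twisted reflections\<close>

locale twisted_reflection_presentation = twisted_reflections commutes root twist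
  for commutes :: "'b \<Rightarrow> 'b \<Rightarrow> bool"
    and root :: "'a \<Rightarrow> 'b"
    and twist :: "'a \<Rightarrow> 'b \<Rightarrow> 'b" +
  fixes S :: "'a set" and R :: "('a word \<times> 'a word) set"
  assumes relations: "R \<subseteq> words S \<times> words S"
    and inj_on_root: "inj_on root S"
    and square: "x \<in> S \<Longrightarrow> ([(x, True), (x, True)], []) \<in> pres_cong S R"
    and swap: "\<lbrakk>x \<in> S; y \<in> S; commutes (root x) (root y)\<rbrakk> \<Longrightarrow>
      \<exists>z\<in>S. \<exists>x'. root z = twist x (root y) \<and>
        ([(x, True), (y, True)], [(z, True), (x', True)]) \<in> pres_cong S R"
begin

abbreviation word_eq (infix \<open>\<approx>\<close> 50) where
  "v \<approx> w \<equiv> (v, w) \<in> pres_cong S R"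

definition left_descent :: "'a word \<Rightarrow> 'b \<Rightarrow> bool" where
  "left_descent w a \<longleftrightarrow>
    (\<exists>x v. x \<in> S \<and> root x = a \<and> w \<approx> (x, True) # v \<and> length w = Suc (length v))"

lemma word_eq_single_True:
  assumes "x \<in> S"
  shows "[(x, b)] \<approx> [(x, True)]"
proof (cases b)
  case True
  then show ?thesis using assms by (auto intro: pres_cong.refl)
next
  case False
  have "[(x, True), (x, True), (x, False)] \<approx> [(x, False)]"
    using pres_cong_append_right[OF relations square, of x "[(x, False)]"] assms by simp
  moreover have "[(x, True), (x, True), (x, False)] \<approx> [(x, True)]"
    using pres_cong.cancel[of "[(x, True)]" S "[]" x True] assms by simp
  ultimately have "[(x, False)] \<approx> [(x, True)]"
    by (rule pres_cong.trans[OF pres_cong.sym])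
  then show ?thesis using False by simp
qed

lemma word_eq_Cons:
  assumes "x \<in> S" "w \<approx> v"
  shows "(x, b) # w \<approx> (x, True) # v"
  using pres_cong_append[OF relations word_eq_single_True[OF assms(1)] assms(2)] by simp

lemma left_descent_Cons:
  assumes "(x, b) # w \<in> words S"
  shows "left_descent ((x, b) # w) (root x)"
proof -
  have "(x, b) # w \<approx> (x, True) # w" using assms by (intro word_eq_Cons pres_cong.refl) auto
  then show ?thesis using assms by (fastforce simp: left_descent_def)
qed

lemma left_descent_Cons_commutes:
  assumes "x \<in> S" and "left_descent w (twist x a)" and "commutes (root x) a"
  shows "left_descent ((x, b) # w) a"
proof -
  obtain y v where y: "y \<in> S" "root y = twist x a" "w \<approx> (y, True) # v"
      "length w = Suc (length v)"
    using assms(2) by (auto simp: left_descent_def)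
  have "commutes (root x) (root y)"
    using assms(3) y(2) by (simp add: commutes_root_twist)
  then obtain z x' where z: "z \<in> S" "root z = a"
      "[(x, True), (y, True)] \<approx> [(z, True), (x', True)]"
    using swap[OF assms(1) y(1)] y(2) by auto
  have "(x, b) # w \<approx> (x, True) # (y, True) # v"
    using assms(1) y(3) by (rule word_eq_Cons)
  also have "(x, True) # (y, True) # v \<approx> (z, True) # (x', True) # v"
    using pres_cong_append_right[OF relations z(3), of v] pres_cong_words[OF relations y(3)] by simp
  finally have "(x, b) # w \<approx> (z, True) # (x', True) # v" .
  with z y(4) show ?thesis unfolding left_descent_def
    by (intro exI[of _ z] exI[of _ "(x', True) # v"]) simp
qed

lemma minimal_word_Cons_not_left_descent:
  assumes "minimal_word S R ((x, b) # w)"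
  shows "\<not> left_descent w (root x)"
proof
  have x: "x \<in> S" using assms by (simp add: minimal_word_def)
  assume "left_descent w (root x)"
  then obtain v where v: "w \<approx> (x, True) # v" "length w = Suc (length v)"
    using x inj_onD[OF inj_on_root] by (auto simp: left_descent_def)
  have "(x, b) # w \<approx> (x, True) # (x, True) # v"
    using x v(1) by (rule word_eq_Cons)
  also have "(x, True) # (x, True) # v \<approx> v"
    using pres_cong_append_right[OF relations square[OF x], of v]
      pres_cong_words[OF relations v(1)] by simp
  finally show False using assms v(2) by (fastforce simp: minimal_word_def)
qed

text \<open>The second conjunct serves the induction: prepending \<open>x\<close> adds twice the value at \<open>root x\<close> to
  the values at indices that do not commute with \<open>root x\<close>.\<close>

definition negative_only_at_descents :: "'a word \<Rightarrow> ('b \<Rightarrow> int) \<Rightarrow> bool" where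
  "negative_only_at_descents w f \<longleftrightarrow>
    (\<forall>a. f a > 0 \<or> f a < 0 \<and> left_descent w a) \<and>
    (\<forall>a b. \<not> commutes a b \<longrightarrow> f a + f b > 0)"

lemma root_pos_if_minimal_word_Cons:
  assumes "minimal_word S R ((x, b) # w)" and "negative_only_at_descents w f"
  shows "f (root x) > 0"
  using assms minimal_word_Cons_not_left_descent by (auto simp: negative_only_at_descents_def)

lemma gen_act_sign:
  assumes min: "minimal_word S R ((x, b) # w)" and signs: "negative_only_at_descents w f"
  shows "gen_act x f a > 0 \<or> gen_act x f a < 0 \<and> left_descent ((x, b) # w) a"
proof -
  have w: "(x, b) # w \<in> words S" using min by (simp add: minimal_word_def)
  have pos: "f (root x) > 0" using assms by (rule root_pos_if_minimal_word_Cons)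
  consider (root) "a = root x" | (commutes) "a \<noteq> root x" "commutes (root x) a"
    | (not_commutes) "\<not> commutes (root x) a"
    by blast
  then show ?thesis
  proof cases
    case root
    then show ?thesis using pos left_descent_Cons[OF w] by (simp add: gen_act_root)
  next
    case commutes
    have "f (twist x a) > 0 \<or> f (twist x a) < 0 \<and> left_descent w (twist x a)"
      using signs by (auto simp: negative_only_at_descents_def)
    then show ?thesis
      using commutes w left_descent_Cons_commutes by (auto simp: gen_act_commutes)
  next
    case not_commutes
    then have "f (root x) + f (twist x a) > 0"
      using signs by (simp add: negative_only_at_descents_def commutes_root_twist)
    then show ?thesis using pos by (simp add: gen_act_not_commutes[OF not_commutes])
  qed
qed

lemma gen_act_sum_pos:
  assumes min: "minimal_word S R ((x, c) # w)" and signs: "negative_only_at_descents w f"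
    and "\<not> commutes a b"
  shows "gen_act x f a + gen_act x f b > 0"
proof -
  have pos: "f (root x) > 0" using min signs by (rule root_pos_if_minimal_word_Cons)
  have root_case: "gen_act x f (root x) + gen_act x f d > 0" if "\<not> commutes (root x) d" for d
  proof -
    have "f (root x) + f (twist x d) > 0"
      using that signs by (simp add: negative_only_at_descents_def commutes_root_twist)
    with that show ?thesis by (simp add: gen_act_root gen_act_not_commutes)
  qed
  have increasing: "gen_act x f d \<ge> f (twist x d)" if "d \<noteq> root x" for d
    using that pos
    by (cases "commutes (root x) d") (simp_all add: gen_act_commutes gen_act_not_commutes)
  consider (left) "a = root x" | (right) "b = root x" | (neither) "a \<noteq> root x" "b \<noteq> root x"
    by blast
  then show ?thesis
  proof cases
    case left
    then show ?thesis using root_case assms(3) by simp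
  next
    case right
    then have "\<not> commutes (root x) a" using assms(3) commutes_sym by blast
    then show ?thesis using root_case[of a] right by simp
  next
    case neither
    have "f (twist x a) + f (twist x b) > 0"
      using signs assms(3) by (simp add: negative_only_at_descents_def commutes_twist)
    then show ?thesis using neither increasing[of a] increasing[of b] by simp
  qed
qed

lemma negative_only_at_descents_word_act:
  assumes "minimal_word S R w"
  shows "negative_only_at_descents w (word_act w (\<lambda>_. 1))"
  using assms
proof (induction w)
  case Nil
  show ?case by (simp add: negative_only_at_descents_def)
next
  case (Cons a w)
  have "negative_only_at_descents w (word_act w (\<lambda>_. 1))"
    using Cons.IH minimal_word_Cons[OF relations Cons.prems] .
  moreover obtain x b where "a = (x, b)" by (cases a)
  ultimately show ?case using Cons.prems gen_act_sign gen_act_sum_pos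
    by (auto simp: negative_only_at_descents_def[of "_ # _"])
qed

theorem word_eq_Nil_if_fixes_one:
  assumes "w \<in> words S" and respects: "\<And>l r f. (l, r) \<in> R \<Longrightarrow> word_act l f = word_act r f"
    and one: "word_act w (\<lambda>_. 1) = (\<lambda>_. 1)"
  shows "w \<approx> []"
proof -
  obtain v where v: "w \<approx> v" "minimal_word S R v" using minimal_word_exists[OF relations assms(1)] .
  have fixes_one: "word_act v (\<lambda>_. 1) = (\<lambda>_. 1)"
    using word_act_pres_cong[OF respects v(1)] one by simp
  have "v = []"
  proof (cases v)
    case (Cons a u)
    obtain x b where a: "a = (x, b)" by (cases a)
    have "minimal_word S R u" using v(2) Cons minimal_word_Cons[OF relations] by blast
    then have "word_act u (\<lambda>_. 1) (root x) > 0"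
      using root_pos_if_minimal_word_Cons negative_only_at_descents_word_act v(2) Cons a by blast
    then have "word_act v (\<lambda>_. 1) (root x) < 0" by (simp add: Cons a gen_act_root)
    then show ?thesis by (simp add: fixes_one)
  qed simp
  with v(1) show ?thesis by simp
qed

end

section \<open>The cactus groups\<close>

definition disjoint_or_nested :: "'a set \<Rightarrow> 'a set \<Rightarrow> bool" where
  "disjoint_or_nested A B \<longleftrightarrow> A \<inter> B = {} \<or> A \<subseteq> B \<or> B \<subseteq> A"

definition span :: "nat \<times> nat \<Rightarrow> nat set" where
  "span x = {fst x..snd x}"

definition reversal :: "nat \<times> nat \<Rightarrow> nat \<Rightarrow> nat" where
  "reversal x k = (if k \<in> span x then fst x + snd x - k else k)"

definition mirror :: "nat \<times> nat \<Rightarrow> nat \<times> nat \<Rightarrow> nat \<times> nat" where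
  "mirror x y = (fst x + snd x - snd y, fst x + snd x - fst y)"

lemma disjoint_or_nested_image:
  "inj h \<Longrightarrow> disjoint_or_nested (h ` A) (h ` B) \<longleftrightarrow> disjoint_or_nested A B"
  by (simp add: disjoint_or_nested_def image_Int[symmetric] inj_image_subset_iff)

lemma reversal_in_span_iff: "reversal x k \<in> span x \<longleftrightarrow> k \<in> span x"
  by (auto simp: reversal_def span_def)

lemma reversal_outside: "k \<notin> span x \<Longrightarrow> reversal x k = k"
  by (simp add: reversal_def)

lemma reversal_involution [simp]: "reversal x (reversal x k) = k"
  by (auto simp: reversal_def span_def)

lemma image_reversal_involution [simp]: "reversal x ` reversal x ` A = A"
  by (simp add: image_image)

lemma inj_reversal: "inj (reversal x)"
  by (metis injI reversal_involution)

lemma image_reversal_disjoint: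
  assumes "span x \<inter> A = {}"
  shows "reversal x ` A = A"
proof -
  have "reversal x k = k" if "k \<in> A" for k
    using assms that by (intro reversal_outside) auto
  then show ?thesis by simp
qed

lemma image_reversal_superset:
  assumes "span x \<subseteq> A"
  shows "reversal x ` A = A"
proof -
  have sub: "reversal x ` A \<subseteq> A"
    using assms reversal_in_span_iff reversal_outside by (metis image_subsetI subsetD)
  then have "reversal x ` reversal x ` A \<subseteq> reversal x ` A" by blast
  with sub show ?thesis by simp
qed

lemma reversal_commute:
  "span x \<inter> span y = {} \<Longrightarrow> reversal x (reversal y k) = reversal y (reversal x k)"
  by (metis disjoint_iff reversal_in_span_iff reversal_outside)

context
  fixes x y :: "nat \<times> nat"
  assumes nonempty: "fst y \<le> snd y" and nested: "span y \<subseteq> span x"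
begin

lemma nested_endpoints: "fst x \<le> fst y" "snd y \<le> snd x"
  using nonempty nested by (auto simp: span_def)

lemma mirror_mirror: "mirror x (mirror x y) = y"
  using nonempty nested_endpoints by (simp add: mirror_def)

lemma leaf_number_mirror: "leaf_number (mirror x y) = leaf_number y"
  using nonempty nested_endpoints by (simp add: mirror_def leaf_number_def split_beta)

lemma span_mirror_subset: "span (mirror x y) \<subseteq> span x"
  using nonempty nested_endpoints by (auto simp: mirror_def span_def)

lemma image_reversal_nested: "reversal x ` span y = span (mirror x y)"
proof
  show "reversal x ` span y \<subseteq> span (mirror x y)"
    using nonempty nested_endpoints by (auto simp: reversal_def span_def mirror_def)
  show "span (mirror x y) \<subseteq> reversal x ` span y"
  proof
    fix k assume "k \<in> span (mirror x y)"
    then have "reversal x k \<in> span y"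
      using nonempty nested_endpoints by (auto simp: reversal_def span_def mirror_def)
    then show "k \<in> reversal x ` span y" by (metis image_eqI reversal_involution)
  qed
qed

lemma reversal_nested: "reversal y (reversal x k) = reversal x (reversal (mirror x y) k)"
proof (cases "k \<in> span (mirror x y)")
  case True
  then have "k \<in> span x" "reversal (mirror x y) k \<in> span x"
    using span_mirror_subset reversal_in_span_iff by blast+
  moreover have "reversal x k \<in> span y"
    using True by (auto simp flip: image_reversal_nested)
  ultimately show ?thesis
    using True nonempty nested_endpoints by (simp add: reversal_def span_def mirror_def) linarith
next
  case False
  then have "reversal x k \<notin> span y"
    using image_reversal_nested by (metis image_eqI reversal_involution)
  with False show ?thesis by (simp add: reversal_outside)
qed

end

lemma cactus_gens_less: "x \<in> cactus_gens n \<Longrightarrow> fst x < snd x"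
  by (auto simp: cactus_gens_def)

lemma mirror_in_cactus_gens:
  assumes "x \<in> cactus_gens n" "y \<in> cactus_gens n" "span y \<subseteq> span x"
  shows "mirror x y \<in> cactus_gens n"
proof -
  have "fst y < snd y" using assms(2) by (rule cactus_gens_less)
  then have "fst x \<le> fst y" "snd y \<le> snd x"
    using nested_endpoints[OF less_imp_le assms(3)] by auto
  with \<open>fst y < snd y\<close> show ?thesis
    using assms(1) by (auto simp: cactus_gens_def mirror_def)
qed

lemma cactus_rels_square: "x \<in> cactus_gens n \<Longrightarrow> ([(x, True), (x, True)], []) \<in> cactus_rels n"
  by (cases x) (simp add: cactus_rels_def)

lemma cactus_rels_disjoint:
  "\<lbrakk>x \<in> cactus_gens n; y \<in> cactus_gens n; span x \<inter> span y = {}\<rbrakk> \<Longrightarrow>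
    ([(x, True), (y, True)], [(y, True), (x, True)]) \<in> cactus_rels n"
  by (cases x; cases y) (simp add: cactus_rels_def span_def)

lemma cactus_rels_nested:
  "\<lbrakk>x \<in> cactus_gens n; y \<in> cactus_gens n; span y \<subseteq> span x\<rbrakk> \<Longrightarrow>
    ([(x, True), (y, True)], [(mirror x y, True), (x, True)]) \<in> cactus_rels n"
  by (cases x; cases y) (simp add: cactus_rels_def span_def mirror_def; blast)

lemma cactus_rels_cases:
  assumes "(l, r) \<in> cactus_rels n"
  obtains (square) x where "l = [(x, True), (x, True)]" "r = []"
  | (disjoint) x y where "l = [(x, True), (y, True)]" "r = [(y, True), (x, True)]"
      "span x \<inter> span y = {}"
  | (nested) x y where "l = [(x, True), (y, True)]" "r = [(mirror x y, True), (x, True)]"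
      "fst y \<le> snd y" "span y \<subseteq> span x"
proof -
  from assms consider
    p q where "l = [s_letter p q, s_letter p q]" "r = []"
  | p q m k where "l = [s_letter p q, s_letter m k]" "r = [s_letter m k, s_letter p q]"
      "{p..q} \<inter> {m..k} = {}"
  | p q m k where "l = [s_letter p q, s_letter m k]"
      "r = [s_letter (p + q - k) (p + q - m), s_letter p q]" "m < k" "{m..k} \<subseteq> {p..q}"
    unfolding cactus_rels_def cactus_gens_def by blast
  then show thesis
    by cases (use that in \<open>simp_all add: span_def mirror_def\<close>)
qed

section \<open>The action of the cactus group\<close>

interpretation cactus:
  twisted_reflections "disjoint_or_nested :: nat set \<Rightarrow> _" span "\<lambda>x. (`) (reversal x)"
proof
  show "disjoint_or_nested (reversal x ` A) (reversal x ` B) \<longleftrightarrow> disjoint_or_nested A B" for x A B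
    using inj_reversal by (rule disjoint_or_nested_image)
qed (auto simp: disjoint_or_nested_def image_reversal_superset)

lemma gen_act_disjoint:
  assumes "span x \<inter> span y = {}"
  shows "cactus.gen_act x (cactus.gen_act y f) = cactus.gen_act y (cactus.gen_act x f)"
proof (rule cactus.gen_act_swap)
  show "disjoint_or_nested (span x) (span y)" using assms by (simp add: disjoint_or_nested_def)
  show "span y = reversal x ` span y" "span x = reversal y ` span x"
    using assms by (auto simp: image_reversal_disjoint Int_commute)
  show "reversal y ` reversal x ` A = reversal x ` reversal y ` A" for A
    using reversal_commute[OF assms] by (simp add: image_image)
qed

lemma gen_act_nested:
  assumes "fst y \<le> snd y" "span y \<subseteq> span x"
  shows "cactus.gen_act x (cactus.gen_act y f) = cactus.gen_act (mirror x y) (cactus.gen_act x f)"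
proof (rule cactus.gen_act_swap)
  show "disjoint_or_nested (span x) (span (mirror x y))"
    using span_mirror_subset[OF assms] by (simp add: disjoint_or_nested_def)
  show "span (mirror x y) = reversal x ` span y"
    using image_reversal_nested[OF assms] ..
  show "span x = reversal (mirror x y) ` span x"
    using image_reversal_superset[OF span_mirror_subset[OF assms]] ..
  show "reversal y ` reversal x ` A = reversal x ` reversal (mirror x y) ` A" for A
    using reversal_nested[OF assms] by (simp add: image_image)
qed

lemma word_act_cactus_rels:
  assumes "(l, r) \<in> cactus_rels n"
  shows "cactus.word_act l f = cactus.word_act r f"
  using assms
proof (cases rule: cactus_rels_cases)
  case square
  then show ?thesis by (simp add: cactus.gen_act_involution)
next
  case disjoint
  then show ?thesis by (simp add: gen_act_disjoint[OF disjoint(3)])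
next
  case nested
  then show ?thesis by (simp add: gen_act_nested)
qed

section \<open>The inclusion of sub-cactus groups\<close>

abbreviation sub_cactus_cong ::
    "nat \<Rightarrow> nat \<Rightarrow> nat \<Rightarrow> ((nat \<times> nat) word \<times> (nat \<times> nat) word) set" where
  "sub_cactus_cong n i j \<equiv> pres_cong (sub_cactus_gens n i j) (sub_cactus_rels n i j)"

lemma sub_cactus_gens_subset: "sub_cactus_gens n i j \<subseteq> cactus_gens n"
  by (auto simp: sub_cactus_gens_def)

lemma mirror_in_sub_cactus_gens:
  assumes "x \<in> sub_cactus_gens n i j" "y \<in> sub_cactus_gens n i j" "span y \<subseteq> span x"
  shows "mirror x y \<in> sub_cactus_gens n i j"
  using assms mirror_in_cactus_gens[of x n y] leaf_number_mirror[of y x] cactus_gens_less[of y n]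
  by (simp add: sub_cactus_gens_def)

lemma inj_on_span: "inj_on span (cactus_gens n)"
  by (auto simp: inj_on_def span_def cactus_gens_def)

lemma sub_cactus_congI:
  "\<lbrakk>(l, r) \<in> cactus_rels n; l \<in> words (sub_cactus_gens n i j); r \<in> words (sub_cactus_gens n i j)\<rbrakk> \<Longrightarrow>
    (l, r) \<in> sub_cactus_cong n i j"
  by (rule pres_cong_relation) (simp add: sub_cactus_rels_def)

lemma sub_cactus_swap:
  assumes x: "x \<in> sub_cactus_gens n i j" and y: "y \<in> sub_cactus_gens n i j"
    and "disjoint_or_nested (span x) (span y)"
  shows "\<exists>z\<in>sub_cactus_gens n i j. \<exists>x'. span z = reversal x ` span y \<and>
    ([(x, True), (y, True)], [(z, True), (x', True)]) \<in> sub_cactus_cong n i j"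
proof -
  have gens: "x \<in> cactus_gens n" "y \<in> cactus_gens n" using x y sub_cactus_gens_subset by auto
  then have le: "fst x \<le> snd x" "fst y \<le> snd y" using cactus_gens_less by (auto intro: less_imp_le)
  consider (disjoint) "span x \<inter> span y = {}" | (inner) "span y \<subseteq> span x" | (outer) "span x \<subseteq> span y"
    using assms(3) by (auto simp: disjoint_or_nested_def)
  then show ?thesis
  proof cases
    case disjoint
    show ?thesis
      using x y gens disjoint
      by (intro bexI[of _ y] exI[of _ x] conjI sub_cactus_congI cactus_rels_disjoint)
        (auto simp: image_reversal_disjoint)
  next
    case inner
    show ?thesis
      using x y gens inner le mirror_in_sub_cactus_gens[OF x y inner]
      by (intro bexI[of _ "mirror x y"] exI[of _ x] conjI sub_cactus_congI cactus_rels_nested)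
        (auto simp: image_reversal_nested)
  next
    case outer
    have z: "mirror y x \<in> sub_cactus_gens n i j" using mirror_in_sub_cactus_gens[OF y x outer] .
    have "([(y, True), (mirror y x, True)], [(x, True), (y, True)]) \<in> cactus_rels n"
      using cactus_rels_nested[of y n "mirror y x"] gens mirror_in_cactus_gens outer
        span_mirror_subset[OF le(1) outer] mirror_mirror[OF le(1) outer] by simp
    then have "([(x, True), (y, True)], [(y, True), (mirror y x, True)]) \<in> sub_cactus_cong n i j"
      using x y z by (intro pres_cong.sym[OF sub_cactus_congI]) auto
    moreover have "span y = reversal x ` span y"
      using image_reversal_superset[OF outer] ..
    ultimately show ?thesis using y by blast
  qed
qed

lemma sub_cactus_rels_words:
  "sub_cactus_rels n i j \<subseteq> words (sub_cactus_gens n i j) \<times> words (sub_cactus_gens n i j)"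
  by (simp add: sub_cactus_rels_def)

interpretation sub_cactus:
  twisted_reflection_presentation "disjoint_or_nested :: nat set \<Rightarrow> _" span "\<lambda>x. (`) (reversal x)"
    "sub_cactus_gens n i j" "sub_cactus_rels n i j" for n i j
proof
  show "inj_on span (sub_cactus_gens n i j)"
    using inj_on_subset[OF inj_on_span sub_cactus_gens_subset] .
  show "([(x, True), (x, True)], []) \<in> sub_cactus_cong n i j"
    if "x \<in> sub_cactus_gens n i j" for x
    using that sub_cactus_gens_subset by (intro sub_cactus_congI cactus_rels_square) auto
qed (rule sub_cactus_rels_words sub_cactus_swap; assumption)+

interpretation sub_cactus_inclusion:
  subpresentation "sub_cactus_gens n i j" "cactus_gens n" "sub_cactus_rels n i j" "cactus_rels n"
  for n i j
proof
  show "sub_cactus_rels n i j \<subseteq> cactus_rels n" by (simp add: sub_cactus_rels_def)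
qed (rule sub_cactus_rels_words cactus_rels_words sub_cactus_gens_subset)+

abbreviation sub_cactus_map :: "nat \<Rightarrow> (nat \<times> nat) word set \<Rightarrow> (nat \<times> nat) word set" where
  "sub_cactus_map n \<equiv> presentation_map (cactus_gens n) (cactus_rels n)"

lemma sub_cactus_map_hom: "sub_cactus_map n \<in> hom (sub_cactus_group n i j) (cactus_group n)"
  using sub_cactus_inclusion.presentation_map_hom
  by (simp add: sub_cactus_group_def cactus_group_def)

lemma sub_cactus_map_gen:
  "x \<in> sub_cactus_gens n i j \<Longrightarrow> sub_cactus_map n (sub_cactus_s n i j x) = cactus_s n x"
  using sub_cactus_inclusion.presentation_map_pres_gen by (simp add: sub_cactus_s_def cactus_s_def)

lemma sub_cactus_map_unique:
  assumes "\<phi> \<in> hom (sub_cactus_group n i j) (cactus_group n)"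
    and "\<forall>x\<in>sub_cactus_gens n i j. \<phi> (sub_cactus_s n i j x) = cactus_s n x"
    and "A \<in> carrier (sub_cactus_group n i j)"
  shows "\<phi> A = sub_cactus_map n A"
proof -
  note hom_eq = hom_eq_on_presented_group[OF sub_cactus_rels_words group_cactus_group,
      folded sub_cactus_group_def sub_cactus_s_def]
  show ?thesis
    by (rule hom_eq[OF assms(1) sub_cactus_map_hom _ assms(3)])
      (simp add: assms(2) sub_cactus_map_gen)
qed

lemma inj_on_sub_cactus_map: "inj_on (sub_cactus_map n) (carrier (sub_cactus_group n i j))"
  unfolding sub_cactus_group_def
proof (rule sub_cactus_inclusion.inj_on_presentation_map)
  fix w
  assume w: "w \<in> words (sub_cactus_gens n i j)"
    and trivial: "(w, []) \<in> pres_cong (cactus_gens n) (cactus_rels n)"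
  have "cactus.word_act w (\<lambda>_. 1) = (\<lambda>_. 1)"
    using cactus.word_act_pres_cong[OF word_act_cactus_rels trivial] by simp
  then show "(w, []) \<in> sub_cactus_cong n i j"
    using w word_act_cactus_rels
    by (intro sub_cactus.word_eq_Nil_if_fixes_one) (auto simp: sub_cactus_rels_def)
qed

theorem theoremA:
  fixes n i j :: nat
  assumes "2 \<le> i" and "i \<le> j" and "j \<le> n"
  shows "(\<exists>\<phi> \<in> hom (sub_cactus_group n i j) (cactus_group n).
            \<forall>g \<in> sub_cactus_gens n i j. \<phi> (sub_cactus_s n i j g) = cactus_s n g) \<and>
         (\<forall>\<phi> \<in> hom (sub_cactus_group n i j) (cactus_group n).
            (\<forall>g \<in> sub_cactus_gens n i j. \<phi> (sub_cactus_s n i j g) = cactus_s n g) \<longrightarrow>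
            inj_on \<phi> (carrier (sub_cactus_group n i j)))"
proof (intro conjI ballI impI)
  show "\<exists>\<phi> \<in> hom (sub_cactus_group n i j) (cactus_group n).
      \<forall>g \<in> sub_cactus_gens n i j. \<phi> (sub_cactus_s n i j g) = cactus_s n g"
    using sub_cactus_map_gen by (intro bexI[OF _ sub_cactus_map_hom]) simp
next
  fix \<phi>
  assume "\<phi> \<in> hom (sub_cactus_group n i j) (cactus_group n)"
    and "\<forall>g \<in> sub_cactus_gens n i j. \<phi> (sub_cactus_s n i j g) = cactus_s n g"
  note unique = sub_cactus_map_unique[OF this]
  show "inj_on \<phi> (carrier (sub_cactus_group n i j))"
    using inj_on_sub_cactus_map by (simp add: unique cong: inj_on_cong)
qed

end
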